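(* Consider mutually independent binary-valued processes $\{l^{(1)}(t)\in\{0,1\}\}_{t\in\mathbb{N}_0}$ and $\{l^{(2)}(t)\in\{0,1\}\}_{t\in\mathbb{N}_0}$ that satisfy $l^{(1)}\in\Gamma_{p_0^{(1)},p_1^{(1)}}$ and $l^{(2)}\in\Lambda_{\rho^{(2)}}$, where $p_0^{(1)},p_1^{(1)},\rho^{(2)}\in[0,1]$ and $p_1^{(1)}\rho^{(2)}<1$. Then the process $\{\tilde l(t)\in\{0,1\}\}_{t\in\mathbb{N}_0}$ defined by $$\tilde l(t)=l^{(1)}(t)\wedge l^{(2)}(t),\quad t\in\mathbb{N}_0,$$ satisfies $\tilde l\in\Lambda_{\tilde\rho}$ for all $\tilde\rho\in(p_1^{(1)}\rho^{(2)},1]$.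
   Context: All processes are defined on a common probability space $(\Omega,\mathcal{F},\mathbb{P})$ with filtration $\{\mathcal{F}_t\}_{t\in\mathbb{N}_0}$. $\wedge$ denotes the and-operation on binary numbers. Class $\Lambda_\rho$: for $\rho\in[0,1]$, $\Lambda_\rho$ is the class of binary-valued processes $l=\{l(t)\in\{0,1\}\}_{t\in\mathbb{N}_0}$ such that $\sum_{k=1}^{\infty}\mathbb{P}[\sum_{t=0}^{k-1}l(t)>\rho k]<\infty$. Hidden Markov models: a binary-valued process $\{l(t)\in\{0,1\}\}_{t\in\mathbb{N}_0}$ is the output process of a time-inhomogeneous hidden Markov model if $l(t)=h^l(\theta^l(t))$, $t\in\mathbb{N}_0$, where $h^l\colon\Theta^l\to\{0,1\}$ is a function on a finite set $\Theta^l$ and $\{\theta^l(t)\in\Theta^l\}_{t\in\mathbb{N}_0}$ is an $\mathcal{F}_t$-adapted, finite-state, time-inhomogeneous Markov chain with initial distribution $\vartheta^l_q\in[0,1]$, $q\in\Theta^l$, and time-varying transition probability functions $p^l_{q,r}\colon\mathbb{N}_0\to[0,1]$, $q,r\in\Theta^l$ (so $\sum_{r\in\Theta^l}p^l_{q,r}(t)=1$), satisfying $\mathbb{P}[\theta^l(0)=q]=\vartheta^l_q$ and $\mathbb{P}[\theta^l(t+1)=r\mid\theta^l(t)=q]=p^l_{q,r}(t)$. Put $\Theta^l_0\triangleq\{r\in\Theta^l\colon h^l(r)=0\}$ and $\Theta^l_1\triangleq\{r\in\Theta^l\colon h^l(r)=1\}$. Class $\Gamma_{p_0,p_1}$: for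 $p_0,p_1\in[0,1]$, $\Gamma_{p_0,p_1}$ is the class of output processes $l$ of time-inhomogeneous hidden Markov models such that $\sum_{r\in\Theta^l_0}p^l_{q,r}(t)\le p_0$ and $\sum_{r\in\Theta^l_1}p^l_{q,r}(t)\le p_1$ for all $q\in\Theta^l$, $t\in\mathbb{N}_0$. *)

theory Defs
  imports "HOL-Probability.Probability"
begin

unbundle bit_operations_syntax

definition binary_process :: "'a measure \<Rightarrow> (nat \<Rightarrow> 'a \<Rightarrow> nat) \<Rightarrow> bool" where
  "binary_process M l \<longleftrightarrow> (\<forall>t. l t \<in> M \<rightarrow>\<^sub>M count_space {0, 1})"

text \<open>The terms of the series are indexed by \<open>k \<ge> 1\<close>; since they are nonnegative reals,
  \<^const>\<open>summable\<close> says that the sum is finite.\<close>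

definition Lambda_processes :: "'a measure \<Rightarrow> real \<Rightarrow> (nat \<Rightarrow> 'a \<Rightarrow> nat) set" where
  "Lambda_processes M \<rho> = {l. binary_process M l \<and>
     summable (\<lambda>k. \<P>(\<omega> in M. real (\<Sum>t<Suc k. l t \<omega>) > \<rho> * real (Suc k)))}"

definition filtration_on :: "'a measure \<Rightarrow> (nat \<Rightarrow> 'a measure) \<Rightarrow> bool" where
  "filtration_on M F \<longleftrightarrow> filtration (space M) F \<and> (\<forall>t. subalgebra M (F t))"

text \<open>A finite-state, time-inhomogeneous Markov chain \<open>\<theta>\<close> adapted to \<open>F\<close>, with state space \<open>\<Theta>\<close>,
  initial distribution \<open>\<pi>\<close> and transition probability functions \<open>p q r t\<close>.  The Markov property is
  the elementary one, relative to the chain's own past (for an adapted chain it follows from the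
  Markov property relative to \<open>F\<close>).  As \<^const>\<open>cond_prob\<close> yields 0 when the condition has
  probability 0, conditional probabilities are only constrained under conditions of positive
  probability; the rows of \<open>p\<close> are stochastic for all states and times regardless.\<close>

definition markov_chain ::
  "'a measure \<Rightarrow> (nat \<Rightarrow> 'a measure) \<Rightarrow> 'q set \<Rightarrow> ('q \<Rightarrow> real) \<Rightarrow> ('q \<Rightarrow> 'q \<Rightarrow> nat \<Rightarrow> real)
    \<Rightarrow> (nat \<Rightarrow> 'a \<Rightarrow> 'q) \<Rightarrow> bool" where
  "markov_chain M F \<Theta> \<pi> p \<theta> \<longleftrightarrow>
     finite \<Theta> \<and>
     (\<forall>t. \<theta> t \<in> F t \<rightarrow>\<^sub>M count_space \<Theta>) \<and>
     (\<forall>q\<in>\<Theta>. \<pi> q \<in> {0..1}) \<and>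
     (\<forall>q\<in>\<Theta>. \<forall>r\<in>\<Theta>. \<forall>t. p q r t \<in> {0..1}) \<and>
     (\<forall>q\<in>\<Theta>. \<forall>t. (\<Sum>r\<in>\<Theta>. p q r t) = 1) \<and>
     (\<forall>q\<in>\<Theta>. \<P>(\<omega> in M. \<theta> 0 \<omega> = q) = \<pi> q) \<and>
     (\<forall>t. \<forall>q\<in>\<Theta>. \<forall>r\<in>\<Theta>. \<P>(\<omega> in M. \<theta> t \<omega> = q) > 0 \<longrightarrow>
        \<P>(\<omega> in M. \<theta> (Suc t) \<omega> = r \<bar> \<theta> t \<omega> = q) = p q r t) \<and>
     (\<forall>t. \<forall>s. \<forall>r\<in>\<Theta>. (\<forall>i\<le>t. s i \<in> \<Theta>) \<longrightarrow> \<P>(\<omega> in M. \<forall>i\<le>t. \<theta> i \<omega> = s i) > 0 \<longrightarrow>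
        \<P>(\<omega> in M. \<theta> (Suc t) \<omega> = r \<bar> \<forall>i\<le>t. \<theta> i \<omega> = s i)
          = \<P>(\<omega> in M. \<theta> (Suc t) \<omega> = r \<bar> \<theta> t \<omega> = s t))"

definition hmm_output ::
  "'a measure \<Rightarrow> (nat \<Rightarrow> 'a measure) \<Rightarrow> 'q set \<Rightarrow> ('q \<Rightarrow> real) \<Rightarrow> ('q \<Rightarrow> 'q \<Rightarrow> nat \<Rightarrow> real)
    \<Rightarrow> (nat \<Rightarrow> 'a \<Rightarrow> 'q) \<Rightarrow> ('q \<Rightarrow> nat) \<Rightarrow> (nat \<Rightarrow> 'a \<Rightarrow> nat) \<Rightarrow> bool" where
  "hmm_output M F \<Theta> \<pi> p \<theta> h l \<longleftrightarrow>
     binary_process M l \<and> markov_chain M F \<Theta> \<pi> p \<theta> \<and> h \<in> \<Theta> \<rightarrow> {0, 1} \<and>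
     (\<forall>t. \<forall>\<omega>\<in>space M. l t \<omega> = h (\<theta> t \<omega>))"

text \<open>HOL cannot quantify existentially over the type that contains the hidden state space, so
  this type is the parameter \<open>'q\<close>.  A theorem assuming \<open>l \<in> Gamma_processes TYPE('q) M F p0 p1\<close> with
  \<open>'q\<close> a type variable covers all finite state spaces.\<close>

definition Gamma_processes ::
  "'q itself \<Rightarrow> 'a measure \<Rightarrow> (nat \<Rightarrow> 'a measure) \<Rightarrow> real \<Rightarrow> real \<Rightarrow> (nat \<Rightarrow> 'a \<Rightarrow> nat) set" where
  "Gamma_processes (_ :: 'q itself) M F p0 p1 =
     {l. \<exists>(\<Theta> :: 'q set) \<pi> p \<theta> h. hmm_output M F \<Theta> \<pi> p \<theta> h l \<and>
        (\<forall>q\<in>\<Theta>. \<forall>t. (\<Sum>r\<in>{r\<in>\<Theta>. h r = 0}. p q r t) \<le> p0 \<and> (\<Sum>r\<in>{r\<in>\<Theta>. h r = 1}. p q r t) \<le> p1)}"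

text \<open>Independence of the two processes as random sequences, i.e. of the sigma-algebras generated
  by all of their coordinates (not merely of \<open>l1 t\<close> and \<open>l2 t\<close> for each \<open>t\<close>).\<close>

definition indep_processes ::
  "'a measure \<Rightarrow> (nat \<Rightarrow> 'a \<Rightarrow> nat) \<Rightarrow> (nat \<Rightarrow> 'a \<Rightarrow> nat) \<Rightarrow> bool" where
  "indep_processes M l1 l2 \<longleftrightarrow>
     prob_space.indep_var M
       (\<Pi>\<^sub>M t\<in>UNIV. count_space {0, 1}) (\<lambda>\<omega> t. l1 t \<omega>)
       (\<Pi>\<^sub>M t\<in>UNIV. count_space {0, 1}) (\<lambda>\<omega> t. l2 t \<omega>)"

end

theory Submission
  imports Defs
begin

text \<open>Split off the event that the first \<open>k\<close> values of \<open>l2\<close> sum to more than \<open>\<rho>2 * k\<close>: its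
  probabilities are summable by assumption. On the complement, decompose over the finitely many
  values \<open>w\<close> of the initial segment of \<open>l2\<close>; by independence each is frozen, and a Chernoff bound
  applies to the weighted sum of \<open>w t * l1 t\<close>. The Markov property gives
  \<open>l1 (t + 1) = 1\<close> conditional probability at most \<open>p1\<close> given the past, so the exponential moment is
  at most \<open>exp c * exp (p1 * (exp c - 1) * \<rho>2 * k)\<close>, where the factor \<open>exp c\<close> pays for the
  unconstrained initial distribution. For small \<open>c > 0\<close> this is beaten by \<open>exp (- c * \<rho> * k)\<close>.\<close>

section \<open>One-step bounds for the hidden chain and its output\<close>

text \<open>Trades integration for finite summation: averaging over the past becomes a sum over its
  finitely many values, so elementary conditional probabilities suffice.\<close>

lemma (in prob_space) expectation_finite_range:
  fixes f :: "'b \<Rightarrow> real"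
  assumes X: "X \<in> M \<rightarrow>\<^sub>M count_space S" and S: "finite S"
  shows "expectation (\<lambda>\<omega>. f (X \<omega>)) = (\<Sum>s\<in>S. f s * \<P>(\<omega> in M. X \<omega> = s))"
proof -
  have m: "{\<omega> \<in> space M. X \<omega> = s} \<in> events" if "s \<in> S" for s
    using measurable_sets[OF X, of "{s}"] that by (simp add: vimage_def Int_def conj_commute)
  have "expectation (\<lambda>\<omega>. f (X \<omega>))
      = expectation (\<lambda>\<omega>. \<Sum>s\<in>S. f s * indicator {\<omega> \<in> space M. X \<omega> = s} \<omega>)"
  proof (rule Bochner_Integration.integral_cong[OF refl])
    fix \<omega> assume w: "\<omega> \<in> space M"
    then have "X \<omega> \<in> S" using measurable_space[OF X] by simp
    then have "f (X \<omega>) = (\<Sum>s\<in>S. if s = X \<omega> then f s else 0)" using S by simp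
    also have "\<dots> = (\<Sum>s\<in>S. f s * indicator {\<omega> \<in> space M. X \<omega> = s} \<omega>)"
      using w by (intro sum.cong) (auto simp: indicator_def)
    finally show "f (X \<omega>) = (\<Sum>s\<in>S. f s * indicator {\<omega> \<in> space M. X \<omega> = s} \<omega>)" .
  qed
  also have "\<dots> = (\<Sum>s\<in>S. f s * \<P>(\<omega> in M. X \<omega> = s))"
    using m by (subst Bochner_Integration.integral_sum)
      (auto intro!: integrable_mult_right integrable_real_indicator simp: emeasure_eq_measure)
  finally show ?thesis .
qed

lemma markov_chain_measurable:
  assumes "markov_chain M F \<Theta> \<pi> p \<theta>" and "filtration_on M F"
  shows "\<theta> t \<in> M \<rightarrow>\<^sub>M count_space \<Theta>"
  using assms measurable_from_subalg unfolding markov_chain_def filtration_on_def by blast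

text \<open>The Markov property reduces conditioning on the whole past to conditioning on
  \<open>s t\<close>; the row bound \<open>le\<close> then applies after summing over
  \<open>r\<close> in \<open>A\<close>. Multiplying through by the probability of the past gives a
  form that also covers null pasts.\<close>

lemma (in prob_space) markov_chain_step_le:
  assumes mc: "markov_chain M F \<Theta> \<pi> p \<theta>" and F: "filtration_on M F"
    and A: "A \<subseteq> \<Theta>" and le: "\<And>q. q \<in> \<Theta> \<Longrightarrow> (\<Sum>r\<in>A. p q r t) \<le> c"
    and s: "\<And>i. i \<le> t \<Longrightarrow> s i \<in> \<Theta>"
  shows "\<P>(\<omega> in M. \<theta> (Suc t) \<omega> \<in> A \<and> (\<forall>i\<le>t. \<theta> i \<omega> = s i))
      \<le> c * \<P>(\<omega> in M. \<forall>i\<le>t. \<theta> i \<omega> = s i)"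
proof -
  let ?Q = "\<lambda>\<omega>. \<forall>i\<le>t. \<theta> i \<omega> = s i"
  have fin: "finite A" using mc A finite_subset by (auto simp: markov_chain_def)
  have th[measurable]: "\<theta> i \<in> M \<rightarrow>\<^sub>M count_space \<Theta>" for i
    by (rule markov_chain_measurable[OF mc F])
  have mQ[measurable]: "{\<omega> \<in> space M. ?Q \<omega>} \<in> events"
  proof -
    have "{\<omega> \<in> space M. \<theta> i \<omega> = s i} \<in> events" if "i \<le> t" for i
      using measurable_sets[OF th[of i], of "{s i}"] s[OF that]
      by (simp add: vimage_def Int_def conj_commute)
    then have "{\<omega> \<in> space M. \<forall>i\<in>{..t}. \<theta> i \<omega> = s i} \<in> events"
      by (intro sets.sets_Collect_finite_All') auto
    then show ?thesis by simp
  qed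
  have mr: "{\<omega> \<in> space M. \<theta> (Suc t) \<omega> = r} \<in> events" if "r \<in> A" for r
    using measurable_sets[OF th[of "Suc t"], of "{r}"] that A
    by (auto simp add: vimage_def Int_def conj_commute)
  have mrQ: "{\<omega> \<in> space M. \<theta> (Suc t) \<omega> = r \<and> ?Q \<omega>} \<in> events" if "r \<in> A" for r
    using sets.Int[OF mr[OF that] mQ] by (simp add: Int_def conj_ac)
  show ?thesis
  proof (cases "prob {\<omega> \<in> space M. ?Q \<omega>} > 0")
    case True
    \<comment> \<open>The chain prescribes \<open>p (s t) r t\<close> only when the current state
      has positive probability; this is inherited from the past having positive probability.\<close>
    have "prob {\<omega> \<in> space M. ?Q \<omega>} \<le> prob {\<omega> \<in> space M. \<theta> t \<omega> = s t}"
      using measurable_sets[OF th[of t], of "{s t}"] s[of t]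
      by (intro finite_measure_mono) (auto simp add: vimage_def Int_def conj_commute)
    with True have pos: "prob {\<omega> \<in> space M. \<theta> t \<omega> = s t} > 0" by linarith
    have step: "prob {\<omega> \<in> space M. \<theta> (Suc t) \<omega> = r \<and> ?Q \<omega>}
        = p (s t) r t * prob {\<omega> \<in> space M. ?Q \<omega>}" if "r \<in> A" for r
    proof -
      have r: "r \<in> \<Theta>" using that A by auto
      have "\<P>(\<omega> in M. \<theta> (Suc t) \<omega> = r \<bar> ?Q \<omega>) = \<P>(\<omega> in M. \<theta> (Suc t) \<omega> = r \<bar> \<theta> t \<omega> = s t)"
        using mc True s r unfolding markov_chain_def by blast
      also have "\<dots> = p (s t) r t"
        using mc pos s[of t] r unfolding markov_chain_def by blast
      finally show ?thesis using True by (simp add: cond_prob_def field_simps)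
    qed
    have "prob {\<omega> \<in> space M. \<theta> (Suc t) \<omega> \<in> A \<and> ?Q \<omega>}
        = prob (\<Union>r\<in>A. {\<omega> \<in> space M. \<theta> (Suc t) \<omega> = r \<and> ?Q \<omega>})"
      by (rule arg_cong[where f = prob]) auto
    also have "\<dots> = (\<Sum>r\<in>A. prob {\<omega> \<in> space M. \<theta> (Suc t) \<omega> = r \<and> ?Q \<omega>})"
      using fin mrQ by (intro finite_measure_finite_Union) (auto simp: disjoint_family_on_def)
    also have "\<dots> = (\<Sum>r\<in>A. p (s t) r t) * prob {\<omega> \<in> space M. ?Q \<omega>}"
      by (simp add: step sum_distrib_right)
    also have "\<dots> \<le> c * prob {\<omega> \<in> space M. ?Q \<omega>}"
      using le[OF s[of t]] by (intro mult_right_mono) auto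
    finally show ?thesis .
  next
    case False
    \<comment> \<open>For a null past the elementary conditional probability says nothing, but both
      sides of the claim vanish.\<close>
    then have 0: "prob {\<omega> \<in> space M. ?Q \<omega>} = 0"
      using measure_nonneg[of M "{\<omega> \<in> space M. ?Q \<omega>}"] by linarith
    have "prob {\<omega> \<in> space M. \<theta> (Suc t) \<omega> \<in> A \<and> ?Q \<omega>} \<le> prob {\<omega> \<in> space M. ?Q \<omega>}"
      by (intro finite_measure_mono mQ) auto
    then show ?thesis by (simp add: 0)
  qed
qed

text \<open>Integrated form of "given the past, the next output is 1 with probability at most
  \<open>c\<close>". The output alone need not be Markov, so the past is refined to the hidden
  trajectory, where the one-step bound holds, and then averaged with the nonnegative weight
  \<open>f\<close>. The restriction to \<open>{..t}\<close> expresses that \<open>f\<close> sees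
  only past outputs.\<close>

lemma (in prob_space) hmm_output_step_le:
  assumes hmm: "hmm_output M F \<Theta> \<pi> p \<theta> h l" and F: "filtration_on M F"
    and le: "\<And>q. q \<in> \<Theta> \<Longrightarrow> (\<Sum>r\<in>{r\<in>\<Theta>. h r = 1}. p q r t) \<le> c"
    and f: "\<And>x. 0 \<le> f x"
  shows "expectation (\<lambda>\<omega>. f (restrict (\<lambda>i. l i \<omega>) {..t}) * real (l (Suc t) \<omega>))
      \<le> c * expectation (\<lambda>\<omega>. f (restrict (\<lambda>i. l i \<omega>) {..t}))"
proof -
  have mc: "markov_chain M F \<Theta> \<pi> p \<theta>" and h: "h \<in> \<Theta> \<rightarrow> {0, 1}"
    and l: "\<And>t \<omega>. \<omega> \<in> space M \<Longrightarrow> l t \<omega> = h (\<theta> t \<omega>)"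
    using hmm by (auto simp: hmm_output_def)
  have fin: "finite \<Theta>" using mc by (simp add: markov_chain_def)
  have th: "\<theta> i \<in> M \<rightarrow>\<^sub>M count_space \<Theta>" for i
    by (rule markov_chain_measurable[OF mc F])
  \<comment> \<open>Cutting trajectories to extensional functions on \<open>{..n}\<close> leaves
    only finitely many of them, so \<open>X n\<close> has finite range.\<close>
  define X where "X n \<omega> = restrict (\<lambda>i. \<theta> i \<omega>) {..n}" for n \<omega>
  define S where "S n = (PiE {..n::nat} (\<lambda>_. \<Theta>))" for n
  have finS: "finite (S n)" for n using fin by (auto simp: S_def intro!: finite_PiE)
  have X_eq: "X n \<omega> = s \<longleftrightarrow> (\<forall>i\<le>n. \<theta> i \<omega> = s i)" if "s \<in> S n" for n \<omega> s
    using that unfolding X_def S_def by (auto simp: fun_eq_iff restrict_def PiE_def extensional_def)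
  have mX: "X n \<in> M \<rightarrow>\<^sub>M count_space (S n)" for n
  proof -
    have "{\<omega> \<in> space M. X n \<omega> = s} \<in> events" if s: "s \<in> S n" for s
    proof -
      have "{\<omega> \<in> space M. \<theta> i \<omega> = s i} \<in> events" if "i \<le> n" for i
        using measurable_sets[OF th[of i], of "{s i}"] s that
        by (simp add: vimage_def Int_def conj_commute S_def PiE_def Pi_def)
      then have "{\<omega> \<in> space M. \<forall>i\<in>{..n}. \<theta> i \<omega> = s i} \<in> events"
        by (intro sets.sets_Collect_finite_All') auto
      then show ?thesis by (simp only: X_eq[OF s] Ball_def atMost_iff)
    qed
    moreover have "X n \<in> space M \<rightarrow> S n"
      using measurable_space[OF th] by (auto simp: X_def S_def)
    ultimately show ?thesis
      using finS by (auto simp: measurable_count_space_eq2 vimage_def Int_def conj_commute)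
  qed
  \<comment> \<open>Any functional of the past outputs is a functional of the hidden trajectory,
    since \<open>h\<close> is applied coordinatewise.\<close>
  define g where "g s = f (restrict (h \<circ> s) {..t})" for s
  have g: "g (X t \<omega>) = f (restrict (\<lambda>i. l i \<omega>) {..t})" if "\<omega> \<in> space M" for \<omega>
    using l that unfolding g_def X_def by (intro arg_cong[where f = f]) auto
  \<comment> \<open>The pair is a function of the trajectory up to \<open>Suc t\<close>, whose
    target space is discrete, so measurability follows from \<open>mX\<close>.\<close>
  have pair: "(\<lambda>\<omega>. (X t \<omega>, \<theta> (Suc t) \<omega>)) \<in> M \<rightarrow>\<^sub>M count_space (S t \<times> \<Theta>)"
  proof -
    have "(\<lambda>x. (restrict x {..t}, x (Suc t))) \<in> count_space (S (Suc t)) \<rightarrow>\<^sub>M count_space (S t \<times> \<Theta>)"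
      by (auto simp: S_def)
    from measurable_compose[OF mX this] show ?thesis
      by (simp add: X_def restrict_def cong: if_cong)
  qed
  have "expectation (\<lambda>\<omega>. f (restrict (\<lambda>i. l i \<omega>) {..t}) * real (l (Suc t) \<omega>))
     = expectation (\<lambda>\<omega>. (\<lambda>(s, r). g s * real (h r)) (X t \<omega>, \<theta> (Suc t) \<omega>))"
    by (intro Bochner_Integration.integral_cong) (auto simp: g l)
  also have "\<dots> = (\<Sum>(s, r)\<in>S t \<times> \<Theta>. g s * real (h r) * \<P>(\<omega> in M. X t \<omega> = s \<and> \<theta> (Suc t) \<omega> = r))"
    by (subst expectation_finite_range[OF pair])
       (auto simp: finS fin intro!: sum.cong)
  also have "\<dots> = (\<Sum>s\<in>S t. g s * (\<Sum>r\<in>\<Theta>. real (h r) * \<P>(\<omega> in M. X t \<omega> = s \<and> \<theta> (Suc t) \<omega> = r)))"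
    by (simp add: sum.cartesian_product[symmetric] sum_distrib_left mult.assoc)
  also have "\<dots> \<le> (\<Sum>s\<in>S t. g s * (c * \<P>(\<omega> in M. X t \<omega> = s)))"
  proof (intro sum_mono mult_left_mono)
    fix s assume s: "s \<in> S t"
    let ?A = "{r\<in>\<Theta>. h r = 1}"
    \<comment> \<open>As \<open>h\<close> is 0 or 1, the weighted sum over next states is the mass
      of those that emit 1.\<close>
    have "(\<Sum>r\<in>\<Theta>. real (h r) * \<P>(\<omega> in M. X t \<omega> = s \<and> \<theta> (Suc t) \<omega> = r))
        = (\<Sum>r\<in>?A. \<P>(\<omega> in M. X t \<omega> = s \<and> \<theta> (Suc t) \<omega> = r))"
      using fin h by (intro sum.mono_neutral_cong_right) (force simp: Pi_iff)+
    also have "\<dots> = prob (\<Union>r\<in>?A. {\<omega> \<in> space M. X t \<omega> = s \<and> \<theta> (Suc t) \<omega> = r})"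
    proof (intro finite_measure_finite_Union[symmetric])
      show "(\<lambda>r. {\<omega> \<in> space M. X t \<omega> = s \<and> \<theta> (Suc t) \<omega> = r}) ` ?A \<subseteq> events"
      proof safe
        fix r assume "r \<in> \<Theta>"
        then show "{\<omega> \<in> space M. X t \<omega> = s \<and> \<theta> (Suc t) \<omega> = r} \<in> events"
          using measurable_sets[OF pair, of "{(s, r)}"] s
          by (simp add: vimage_def Int_def conj_commute)
      qed
    qed (use fin in \<open>auto simp: disjoint_family_on_def\<close>)
    also have "\<dots> = \<P>(\<omega> in M. \<theta> (Suc t) \<omega> \<in> ?A \<and> (\<forall>i\<le>t. \<theta> i \<omega> = s i))"
      using measurable_space[OF th] X_eq[OF s] by (intro arg_cong[where f = prob]) auto
    also have "\<dots> \<le> c * \<P>(\<omega> in M. \<forall>i\<le>t. \<theta> i \<omega> = s i)"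
      using s le by (intro markov_chain_step_le[OF mc F]) (auto simp: S_def)
    also have "\<dots> = c * \<P>(\<omega> in M. X t \<omega> = s)"
      by (simp add: X_eq[OF s])
    finally show "(\<Sum>r\<in>\<Theta>. real (h r) * \<P>(\<omega> in M. X t \<omega> = s \<and> \<theta> (Suc t) \<omega> = r))
        \<le> c * \<P>(\<omega> in M. X t \<omega> = s)" .
  qed (simp add: g_def f)
  also have "\<dots> = c * (\<Sum>s\<in>S t. g s * \<P>(\<omega> in M. X t \<omega> = s))"
    by (simp add: sum_distrib_left mult_ac)
  also have "(\<Sum>s\<in>S t. g s * \<P>(\<omega> in M. X t \<omega> = s)) = expectation (\<lambda>\<omega>. g (X t \<omega>))"
    by (simp add: expectation_finite_range[OF mX finS])
  also have "\<dots> = expectation (\<lambda>\<omega>. f (restrict (\<lambda>i. l i \<omega>) {..t}))"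
    by (intro Bochner_Integration.integral_cong) (auto simp: g)
  finally show ?thesis .
qed

section \<open>Exponential moments and Chernoff bounds for fixed weights\<close>

lemma binary_processD:
  assumes "binary_process M l"
  shows "\<omega> \<in> space M \<Longrightarrow> l t \<omega> = 0 \<or> l t \<omega> = 1"
    and "(\<lambda>\<omega>. real (l t \<omega>)) \<in> borel_measurable M"
proof -
  have m: "l t \<in> M \<rightarrow>\<^sub>M count_space {0, 1}" using assms by (simp add: binary_process_def)
  show "\<omega> \<in> space M \<Longrightarrow> l t \<omega> = 0 \<or> l t \<omega> = 1"
    using measurable_space[OF m] by auto
  show "(\<lambda>\<omega>. real (l t \<omega>)) \<in> borel_measurable M"
    by (rule measurable_compose[OF m]) simp
qed

text \<open>Peeling off the last time multiplies the moment by at most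
  \<open>1 + p1 * (exp c - 1) * w t\<close>, hence by at most the exponential of the second summand.
  Times of weight 0 cost nothing, so the exponent counts only times of weight 1.\<close>

lemma (in prob_space) hmm_output_exp_moment:
  assumes hmm: "hmm_output M F \<Theta> \<pi> p \<theta> h l" and F: "filtration_on M F"
    and le: "\<And>q t. q \<in> \<Theta> \<Longrightarrow> (\<Sum>r\<in>{r\<in>\<Theta>. h r = 1}. p q r t) \<le> p1"
    and p1: "0 \<le> p1" and c: "0 \<le> c" and w: "\<And>t. w t = 0 \<or> w t = 1"
  shows "expectation (\<lambda>\<omega>. exp (c * (\<Sum>t<Suc k. w t * real (l t \<omega>))))
      \<le> exp c * exp (p1 * (exp c - 1) * (\<Sum>t<Suc k. w t))"
proof -
  have bp: "binary_process M l" using hmm by (simp add: hmm_output_def)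
  note [measurable] = binary_processD(2)[OF bp]
  have l01: "l t \<omega> = 0 \<or> l t \<omega> = 1" if "\<omega> \<in> space M" for t \<omega>
    using binary_processD(1)[OF bp that] .
  let ?S = "\<lambda>n \<omega>. \<Sum>t<n. w t * real (l t \<omega>)"
  \<comment> \<open>The power \<open>j\<close> makes one bound serve two integrands:
    \<open>j = 1\<close> keeps the extra factor, \<open>j = 0\<close> leaves the bare
    exponential.\<close>
  have int: "integrable M (\<lambda>\<omega>. exp (c * ?S n \<omega>) * real (l m \<omega>) ^ j)" for n m j
  proof (rule integrable_const_bound)
    show "AE \<omega> in M. norm (exp (c * ?S n \<omega>) * real (l m \<omega>) ^ j) \<le> exp (c * real n)"
    proof (rule AE_I2)
      fix \<omega> assume o: "\<omega> \<in> space M"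
      have "w t * real (l t \<omega>) \<le> 1" for t using w[of t] l01[OF o, of t] by auto
      then have "?S n \<omega> \<le> (\<Sum>t<n. 1)" by (intro sum_mono) 
      then have "exp (c * ?S n \<omega>) \<le> exp (c * real n)" using c by (auto intro: mult_left_mono)
      moreover have "real (l m \<omega>) ^ j \<le> 1" using l01[OF o, of m] by (auto simp: power_0_left)
      ultimately have "exp (c * ?S n \<omega>) * real (l m \<omega>) ^ j \<le> exp (c * real n) * 1"
        by (intro mult_mono) auto
      then show "norm (exp (c * ?S n \<omega>) * real (l m \<omega>) ^ j) \<le> exp (c * real n)"
        by (simp add: abs_mult)
    qed
  qed measurable
  have int1: "integrable M (\<lambda>\<omega>. exp (c * ?S n \<omega>) * real (l m \<omega>))" for n m
    using int[of n m 1] by simp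
  have int0: "integrable M (\<lambda>\<omega>. exp (c * ?S n \<omega>))" for n
    using int[of n 0 0] by simp
  show ?thesis
  proof (induction k)
    case 0
    \<comment> \<open>At time 0 no transition has occurred yet, so only the trivial bound is
      available; this is the sole source of the factor \<open>exp c\<close>.\<close>
    have "expectation (\<lambda>\<omega>. exp (c * ?S (Suc 0) \<omega>)) \<le> exp c"
    proof (rule integral_le_const[OF int0], rule AE_I2)
      fix \<omega> assume "\<omega> \<in> space M"
      then show "exp (c * ?S (Suc 0) \<omega>) \<le> exp c"
        using w[of 0] l01[of \<omega> 0] c by auto
    qed
    also have "\<dots> \<le> exp c * exp (p1 * (exp c - 1) * (\<Sum>t<Suc 0. w t))"
    proof -
      have "0 \<le> p1 * (exp c - 1) * w 0" using p1 c w[of 0] by auto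
      then show ?thesis by simp
    qed
    finally show ?case .
  next
    case (Suc k)
    let ?n = "Suc k"
    let ?a = "(exp c - 1) * w ?n"
    have a: "0 \<le> ?a" using c w[of ?n] by auto
    have "expectation (\<lambda>\<omega>. exp (c * ?S (Suc ?n) \<omega>))
        = expectation (\<lambda>\<omega>. exp (c * ?S ?n \<omega>) + ?a * (exp (c * ?S ?n \<omega>) * real (l ?n \<omega>)))"
    proof (intro Bochner_Integration.integral_cong refl)
      fix \<omega> assume "\<omega> \<in> space M"
      have "exp (c * ?S (Suc ?n) \<omega>) = exp (c * ?S ?n \<omega>) * exp (c * (w ?n * real (l ?n \<omega>)))"
        by (simp only: sum.lessThan_Suc[of _ ?n] distrib_left exp_add)
      \<comment> \<open>The exponential is affine on {0, 1}, so this linearisation is exact.\<close>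
      also have "exp (c * (w ?n * real (l ?n \<omega>))) = 1 + ?a * real (l ?n \<omega>)"
        using w[of ?n] l01[OF \<open>\<omega> \<in> space M\<close>, of ?n] by auto
      finally show "exp (c * ?S (Suc ?n) \<omega>)
          = exp (c * ?S ?n \<omega>) + ?a * (exp (c * ?S ?n \<omega>) * real (l ?n \<omega>))"
        by (simp only: distrib_left mult_1_right mult.left_commute)
    qed
    also have "\<dots> = expectation (\<lambda>\<omega>. exp (c * ?S ?n \<omega>))
        + ?a * expectation (\<lambda>\<omega>. exp (c * ?S ?n \<omega>) * real (l ?n \<omega>))"
      using int0[of ?n] int1[of ?n ?n]
      by (subst Bochner_Integration.integral_add) (auto intro!: integrable_mult_right simp del: sum.lessThan_Suc)
    also have "\<dots> \<le> expectation (\<lambda>\<omega>. exp (c * ?S ?n \<omega>))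
        + ?a * (p1 * expectation (\<lambda>\<omega>. exp (c * ?S ?n \<omega>)))"
    proof -
      \<comment> \<open>The partial sum involves times up to \<open>k\<close> only, so its
        exponential is an admissible \<open>f\<close> for the step from \<open>k\<close> to
        \<open>Suc k\<close>.\<close>
      have "(\<Sum>t<?n. w t * real (restrict (\<lambda>i. l i \<omega>) {..k} t)) = ?S ?n \<omega>" for \<omega>
        by (intro sum.cong) auto
      then have "expectation (\<lambda>\<omega>. exp (c * ?S ?n \<omega>) * real (l ?n \<omega>))
          \<le> p1 * expectation (\<lambda>\<omega>. exp (c * ?S ?n \<omega>))"
        using hmm_output_step_le[OF hmm F, of k p1 "\<lambda>x. exp (c * (\<Sum>t<?n. w t * real (x t)))"] le
        by (simp del: sum.lessThan_Suc)
      then show ?thesis using a by (intro add_left_mono mult_left_mono)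
    qed
    also have "\<dots> = (1 + p1 * ?a) * expectation (\<lambda>\<omega>. exp (c * ?S ?n \<omega>))"
      by (simp add: algebra_simps del: sum.lessThan_Suc)
    \<comment> \<open>Uses \<open>1 + x\<close> \<le> \<open>exp x\<close>, then the induction
      hypothesis.\<close>
    also have "\<dots> \<le> exp (p1 * ?a) * (exp c * exp (p1 * (exp c - 1) * (\<Sum>t<?n. w t)))"
      using Suc a p1 by (intro mult_mono exp_ge_add_one_self) (auto simp del: sum.lessThan_Suc)
    also have "\<dots> = exp c * exp (p1 * ?a + p1 * (exp c - 1) * (\<Sum>t<?n. w t))"
      by (simp only: exp_add mult.left_commute)
    also have "p1 * ?a + p1 * (exp c - 1) * (\<Sum>t<?n. w t) = p1 * (exp c - 1) * (\<Sum>t<Suc ?n. w t)"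
      by (simp only: sum.lessThan_Suc[of _ ?n] distrib_left mult.assoc add.commute)
    finally show ?case .
  qed
qed

text \<open>Markov's inequality for the exponential of the weighted sum; \<open>c\<close> stays free
  and is optimised against \<open>a\<close> only at the end.\<close>

lemma (in prob_space) hmm_output_weighted_tail:
  assumes hmm: "hmm_output M F \<Theta> \<pi> p \<theta> h l" and F: "filtration_on M F"
    and le: "\<And>q t. q \<in> \<Theta> \<Longrightarrow> (\<Sum>r\<in>{r\<in>\<Theta>. h r = 1}. p q r t) \<le> p1"
    and p1: "0 \<le> p1" and c: "0 < c" and w: "\<And>t. w t = 0 \<or> w t = 1"
  shows "\<P>(\<omega> in M. (\<Sum>t<Suc k. w t * real (l t \<omega>)) > a)
      \<le> exp c * exp (p1 * (exp c - 1) * (\<Sum>t<Suc k. w t)) * exp (- c * a)"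
proof -
  have bp: "binary_process M l" using hmm by (simp add: hmm_output_def)
  note [measurable] = binary_processD(2)[OF bp]
  let ?S = "\<lambda>\<omega>. \<Sum>t<Suc k. w t * real (l t \<omega>)"
  have int: "integrable M (\<lambda>\<omega>. exp (c * ?S \<omega>))"
  proof (rule integrable_const_bound)
    show "AE \<omega> in M. norm (exp (c * ?S \<omega>)) \<le> exp (c * real (Suc k))"
    proof (rule AE_I2)
      fix \<omega> assume o: "\<omega> \<in> space M"
      have "w t * real (l t \<omega>) \<le> 1" for t
        using w[of t] binary_processD(1)[OF bp o, of t] by auto
      then have "?S \<omega> \<le> (\<Sum>t<Suc k. 1)" by (intro sum_mono)
      then show "norm (exp (c * ?S \<omega>)) \<le> exp (c * real (Suc k))"
        using c by (auto simp del: sum.lessThan_Suc)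
    qed
  qed measurable
  have "\<P>(\<omega> in M. ?S \<omega> > a) \<le> \<P>(\<omega> in M. exp (c * ?S \<omega>) \<ge> exp (c * a))"
    using c by (intro finite_measure_mono) (auto simp del: sum.lessThan_Suc)
  also have "\<dots> \<le> expectation (\<lambda>\<omega>. exp (c * ?S \<omega>)) / exp (c * a)"
    using int by (intro integral_Markov_inequality_measure[where A = "{}"]) auto
  also have "\<dots> \<le> exp c * exp (p1 * (exp c - 1) * (\<Sum>t<Suc k. w t)) / exp (c * a)"
    using hmm_output_exp_moment[OF hmm F le p1 _ w, where c = c and k = k] c
    by (intro divide_right_mono) (auto simp del: sum.lessThan_Suc)
  finally show ?thesis by (simp add: exp_minus divide_inverse)
qed

text \<open>To first order \<open>exp c - 1\<close> is \<open>c\<close>, so the gap between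
  \<open>a\<close> and \<rho> wins for small \<open>c\<close>. Half the gap works: it is at most 1,
  which allows \<open>exp c\<close> \<le> \<open>1 + c + c^2\<close>, and with \<open>a\<close>
  \<le> 1 it gives \<open>a * (1 + c)\<close> \<le> \<open>a + c\<close> < \<rho>.\<close>

lemma exists_exponent:
  fixes a \<rho> :: real
  assumes "0 \<le> a" "a < \<rho>" "\<rho> \<le> 1"
  obtains c where "0 < c" "a * (exp c - 1) < c * \<rho>"
proof
  let ?c = "(\<rho> - a) / 2"
  show c: "0 < ?c" using assms by simp
  have "exp ?c \<le> 1 + ?c + ?c\<^sup>2" using assms by (intro exp_bound) auto
  then have "a * (exp ?c - 1) \<le> a * (?c + ?c\<^sup>2)" using assms by (intro mult_left_mono) auto
  also have "\<dots> = ?c * (a + a * ?c)" by (simp add: algebra_simps power2_eq_square)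
  also have "\<dots> < ?c * \<rho>"
  proof (rule mult_strict_left_mono[OF _ c])
    have "a * ?c \<le> 1 * ?c" using assms by (intro mult_right_mono) auto
    then have "a + a * ?c \<le> a + ?c" by simp
    also have "\<dots> < \<rho>" using assms by (simp add: field_simps)
    finally show "a + a * ?c < \<rho>" .
  qed
  finally show "a * (exp ?c - 1) < ?c * \<rho>" .
qed

section \<open>Freezing the independent second process\<close>

text \<open>On each initial segment \<open>w\<close> of \<open>l2\<close> the product sum is a
  weighted sum of \<open>l1\<close> with deterministic 0/1 weights, at most \<open>b\<close> of them
  equal to 1. Independence factors out the probability of the segment, and the bound for
  \<open>l1\<close> is uniform over segments.\<close>

lemma (in prob_space) indep_processes_tail:
  assumes hmm: "hmm_output M F \<Theta> \<pi> p \<theta> h l1" and F: "filtration_on M F"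
    and le: "\<And>q t. q \<in> \<Theta> \<Longrightarrow> (\<Sum>r\<in>{r\<in>\<Theta>. h r = 1}. p q r t) \<le> p1"
    and p1: "0 \<le> p1" and c: "0 < c"
    and l2: "binary_process M l2" and ind: "indep_processes M l1 l2"
  shows "\<P>(\<omega> in M. real (\<Sum>t<Suc k. l1 t \<omega> * l2 t \<omega>) > a \<and> real (\<Sum>t<Suc k. l2 t \<omega>) \<le> b)
      \<le> exp c * exp (p1 * (exp c - 1) * b) * exp (- c * a)"
proof -
  have l1: "binary_process M l1" using hmm by (simp add: hmm_output_def)
  let ?N = "\<Pi>\<^sub>M t\<in>(UNIV :: nat set). count_space {0, 1 :: nat}"
  let ?K = "exp c * exp (p1 * (exp c - 1) * b) * exp (- c * a)"
  define W where "W = {w \<in> PiE {..<Suc k} (\<lambda>_. {0, 1 :: nat}). real (\<Sum>t<Suc k. w t) \<le> b}"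
  define A where "A w = {x \<in> space ?N. (\<Sum>t<Suc k. real (w t) * real (x t)) > a}" for w :: "nat \<Rightarrow> nat"
  \<comment> \<open>Equality is stated between real values so that measurability follows from
    \<open>comp\<close>.\<close>
  define B where "B w = {x \<in> space ?N. \<forall>t\<in>{..<Suc k}. real (x t) = real (w t)}" for w :: "nat \<Rightarrow> nat"
  define U where "U w = {\<omega> \<in> space M. (\<Sum>t<Suc k. real (w t) * real (l1 t \<omega>)) > a}" for w
  define V where "V w = {\<omega> \<in> space M. \<forall>t<Suc k. l2 t \<omega> = w t}" for w
  have finW: "finite W"
    unfolding W_def by (rule finite_subset[of _ "PiE {..<Suc k} (\<lambda>_. {0, 1})"]) (auto intro!: finite_PiE)
  have ind': "indep_var ?N (\<lambda>\<omega> t. l1 t \<omega>) ?N (\<lambda>\<omega> t. l2 t \<omega>)"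
    using ind by (simp add: indep_processes_def)
  have comp[measurable]: "(\<lambda>x. real (x t)) \<in> borel_measurable ?N" for t
    by (rule measurable_compose[OF measurable_component_singleton[of t]]) auto
  have A: "A w \<in> sets ?N" and B: "B w \<in> sets ?N" for w
    unfolding A_def B_def by measurable
  have spN: "(\<lambda>t. l t \<omega>) \<in> space ?N" if "binary_process M l" "\<omega> \<in> space M" for l \<omega>
    using binary_processD(1)[OF that] by (auto simp: space_PiM PiE_def)
  have UA: "(\<lambda>\<omega> t. l1 t \<omega>) -` A w \<inter> space M = U w" for w
    using spN[OF l1] by (auto simp: A_def U_def simp del: sum.lessThan_Suc)
  have VB: "(\<lambda>\<omega> t. l2 t \<omega>) -` B w \<inter> space M = V w" for w
    using spN[OF l2] by (auto simp: B_def V_def)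
  have Ue: "U w \<in> events" for w
    using measurable_sets[OF indep_var_rv1[OF ind'] A] by (simp add: UA)
  have Ve: "V w \<in> events" for w
    using measurable_sets[OF indep_var_rv2[OF ind'] B] by (simp add: VB)
  have prod: "prob (U w \<inter> V w) = prob (U w) * prob (V w)" for w
  proof -
    have "(\<lambda>\<omega>. (\<lambda>t. l1 t \<omega>, \<lambda>t. l2 t \<omega>)) -` (A w \<times> B w) \<inter> space M = U w \<inter> V w"
      using UA[of w] VB[of w] by blast
    then show ?thesis using indep_varD[OF ind' A B, of w w] by (simp add: UA VB)
  qed
  have Ule: "prob (U w) \<le> ?K" if w: "w \<in> W" for w
  proof -
    \<comment> \<open>The tail bound wants 0/1 weights at all times, whereas \<open>w\<close> is
      unspecified as a number off its domain; extending by 0 leaves the sum up to \<open>k\<close>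
      unchanged.\<close>
    define v where "v t = (if t < Suc k then real (w t) else 0)" for t
    have v: "v t = 0 \<or> v t = 1" for t
      using w by (auto simp: W_def v_def PiE_def Pi_def)
    have sv: "(\<Sum>t<Suc k. v t * z t) = (\<Sum>t<Suc k. real (w t) * z t)" for z :: "nat \<Rightarrow> real"
      by (intro sum.cong) (auto simp: v_def)
    have "prob (U w) \<le> exp c * exp (p1 * (exp c - 1) * (\<Sum>t<Suc k. v t)) * exp (- c * a)"
      unfolding U_def sv[symmetric]
      by (rule hmm_output_weighted_tail[where w = v, OF hmm F _ p1 c]) (use le v in auto)
    also have "\<dots> \<le> ?K"
    proof -
      have "(\<Sum>t<Suc k. v t) \<le> b" using w sv[of "\<lambda>_. 1"] by (simp add: W_def)
      then show ?thesis using p1 c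
        by (intro mult_right_mono mult_left_mono) (auto intro!: mult_left_mono simp del: sum.lessThan_Suc)
    qed
    finally show ?thesis .
  qed
  have "\<P>(\<omega> in M. real (\<Sum>t<Suc k. l1 t \<omega> * l2 t \<omega>) > a \<and> real (\<Sum>t<Suc k. l2 t \<omega>) \<le> b)
      \<le> prob (\<Union>w\<in>W. U w \<inter> V w)"
  proof (rule finite_measure_mono)
    show "(\<Union>w\<in>W. U w \<inter> V w) \<in> events" using Ue Ve finW by (intro sets.finite_UN) auto
    show "{\<omega> \<in> space M. real (\<Sum>t<Suc k. l1 t \<omega> * l2 t \<omega>) > a \<and> real (\<Sum>t<Suc k. l2 t \<omega>) \<le> b}
        \<subseteq> (\<Union>w\<in>W. U w \<inter> V w)"
    proof (safe)
      fix \<omega> assume o: "\<omega> \<in> space M" and gt: "real (\<Sum>t<Suc k. l1 t \<omega> * l2 t \<omega>) > a"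
        and lb: "real (\<Sum>t<Suc k. l2 t \<omega>) \<le> b"
      let ?w = "restrict (\<lambda>t. l2 t \<omega>) {..<Suc k}"
      have "(\<Sum>t<Suc k. ?w t) = (\<Sum>t<Suc k. l2 t \<omega>)" by (intro sum.cong) auto
      then have "?w \<in> W" using lb binary_processD(1)[OF l2 o]
        by (auto simp: W_def simp del: sum.lessThan_Suc)
      moreover have "(\<Sum>t<Suc k. real (?w t) * real (l1 t \<omega>)) = real (\<Sum>t<Suc k. l1 t \<omega> * l2 t \<omega>)"
        unfolding of_nat_sum by (intro sum.cong) auto
      then have "\<omega> \<in> U ?w" using o gt by (simp only: U_def mem_Collect_eq)
      moreover have "\<omega> \<in> V ?w" using o by (simp add: V_def)
      ultimately show "\<omega> \<in> (\<Union>w\<in>W. U w \<inter> V w)" by blast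
    qed
  qed
  also have "\<dots> \<le> (\<Sum>w\<in>W. prob (U w \<inter> V w))"
    using Ue Ve finW by (intro finite_measure_subadditive_finite) auto
  also have "\<dots> \<le> (\<Sum>w\<in>W. ?K * prob (V w))"
    unfolding prod using Ule by (intro sum_mono mult_right_mono) auto
  \<comment> \<open>The segment events are disjoint, so their probabilities add up to at most 1 and
    the number of segments does not enter the bound.\<close>
  also have "\<dots> = ?K * prob (\<Union>w\<in>W. V w)"
  proof -
    have "w = w'" if "w \<in> W" "w' \<in> W" "\<omega> \<in> V w" "\<omega> \<in> V w'" for w w' \<omega>
      using that by (intro PiE_ext[of w "{..<Suc k}" "\<lambda>_. {0, 1}" w']) (auto simp: W_def V_def)
    then have "disjoint_family_on V W" by (auto simp: disjoint_family_on_def)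
    then have "prob (\<Union>w\<in>W. V w) = (\<Sum>w\<in>W. prob (V w))"
      using Ve finW by (intro finite_measure_finite_Union) auto
    then show ?thesis by (simp add: sum_distrib_left)
  qed
  also have "\<dots> \<le> ?K * 1" by (intro mult_left_mono prob_le_1) auto
  finally show ?thesis by simp
qed

section \<open>Summability of the tail probabilities\<close>

theorem theorem3p4:
  fixes M :: "'a measure" and F :: "nat \<Rightarrow> 'a measure"
    and l1 l2 :: "nat \<Rightarrow> 'a \<Rightarrow> nat"
    and p0 p1 \<rho>2 :: real
  assumes "prob_space M"
    and "filtration_on M F"
    and "binary_process M l1" and "binary_process M l2"
    and "indep_processes M l1 l2"
    and "p0 \<in> {0..1}" and "p1 \<in> {0..1}" and "\<rho>2 \<in> {0..1}"
    and "l1 \<in> Gamma_processes TYPE('q) M F p0 p1"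
    and "l2 \<in> Lambda_processes M \<rho>2"
    and "p1 * \<rho>2 < 1"
  shows "\<forall>\<rho>\<in>{p1 * \<rho>2<..1}. (\<lambda>t \<omega>. l1 t \<omega> AND l2 t \<omega>) \<in> Lambda_processes M \<rho>"
proof
  interpret prob_space M by fact
  fix \<rho> assume "\<rho> \<in> {p1 * \<rho>2<..1}"
  then have \<rho>: "p1 * \<rho>2 < \<rho>" "\<rho> \<le> 1" by auto
  let ?l = "\<lambda>t \<omega>. l1 t \<omega> AND l2 t \<omega>"
  note l1 = \<open>binary_process M l1\<close> and l2 = \<open>binary_process M l2\<close>
  have p1: "0 \<le> p1" and \<rho>2: "0 \<le> \<rho>2" using assms by auto
  obtain \<Theta> :: "'q set" and \<pi> p \<theta> h where hmm: "hmm_output M F \<Theta> \<pi> p \<theta> h l1"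
    and le: "\<And>q t. q \<in> \<Theta> \<Longrightarrow> (\<Sum>r\<in>{r\<in>\<Theta>. h r = 1}. p q r t) \<le> p1"
    using \<open>l1 \<in> Gamma_processes TYPE('q) M F p0 p1\<close> unfolding Gamma_processes_def by blast
  obtain c where c: "0 < c" "p1 * \<rho>2 * (exp c - 1) < c * \<rho>"
    using exists_exponent[of "p1 * \<rho>2" \<rho>] p1 \<rho>2 \<rho> by auto
  \<comment> \<open>The exponential decay rate per time step left over after the moment growth is
    subtracted.\<close>
  define d where "d = c * \<rho> - p1 * \<rho>2 * (exp c - 1)"
  have d: "0 < d" using c by (simp add: d_def)
  \<comment> \<open>On bits AND is multiplication, which turns the conjunction into
    \<open>l1\<close> weighted by \<open>l2\<close>.\<close>
  have and_eq: "?l t \<omega> = l1 t \<omega> * l2 t \<omega>" if "\<omega> \<in> space M" for t \<omega>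
    using binary_processD(1)[OF l1 that, of t] binary_processD(1)[OF l2 that, of t] by auto
  have bin: "binary_process M ?l"
    unfolding binary_process_def
  proof
    fix t
    have [measurable]: "l1 t \<in> M \<rightarrow>\<^sub>M count_space {0, 1}" "l2 t \<in> M \<rightarrow>\<^sub>M count_space {0, 1}"
      using l1 l2 by (auto simp: binary_process_def)
    have m: "(\<lambda>\<omega>. (l1 t \<omega>, l2 t \<omega>)) \<in> M \<rightarrow>\<^sub>M count_space {0, 1} \<Otimes>\<^sub>M count_space {0, 1}"
      by measurable
    \<comment> \<open>The product of these finite discrete spaces is again discrete, so it only
      remains to see that AND stays within {0, 1}.\<close>
    have "(\<lambda>(x, y). x AND y) \<in> count_space {0, 1} \<Otimes>\<^sub>M count_space {0, 1} \<rightarrow>\<^sub>M count_space {0, 1 :: nat}"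
      by (auto simp: pair_measure_countable)
    from measurable_compose[OF m this] show "?l t \<in> M \<rightarrow>\<^sub>M count_space {0, 1}" by simp
  qed
  note [measurable] = binary_processD(2)[OF l1] binary_processD(2)[OF l2] binary_processD(2)[OF bin]
  let ?P2 = "\<lambda>k. \<P>(\<omega> in M. real (\<Sum>t<Suc k. l2 t \<omega>) > \<rho>2 * real (Suc k))"
  have bound: "\<P>(\<omega> in M. real (\<Sum>t<Suc k. ?l t \<omega>) > \<rho> * real (Suc k))
      \<le> ?P2 k + exp c * exp (- d) ^ Suc k" for k
  proof -
    let ?E = "{\<omega> \<in> space M. real (\<Sum>t<Suc k. l1 t \<omega> * l2 t \<omega>) > \<rho> * real (Suc k)
        \<and> real (\<Sum>t<Suc k. l2 t \<omega>) \<le> \<rho>2 * real (Suc k)}"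
    let ?G = "{\<omega> \<in> space M. real (\<Sum>t<Suc k. l2 t \<omega>) > \<rho>2 * real (Suc k)}"
    have mE: "?E \<in> events" and mG: "?G \<in> events"
      unfolding of_nat_sum of_nat_mult by measurable
    have "(\<Sum>t<Suc k. ?l t \<omega>) = (\<Sum>t<Suc k. l1 t \<omega> * l2 t \<omega>)" if "\<omega> \<in> space M" for \<omega>
      using and_eq[OF that] by (intro sum.cong) auto
    then have "\<P>(\<omega> in M. real (\<Sum>t<Suc k. ?l t \<omega>) > \<rho> * real (Suc k)) \<le> prob (?G \<union> ?E)"
      using mE mG by (intro finite_measure_mono sets.Un) (auto simp del: sum.lessThan_Suc of_nat_Suc of_nat_sum)
    also have "\<dots> \<le> prob ?G + prob ?E"
      using mE mG by (intro measure_Un_le)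
    \<comment> \<open>Here the threshold is \<rho> and the budget \<open>b\<close> is \<rho>2, both
      times the length \<open>Suc k\<close>; the exponents then combine to
      \<open>- d * Suc k\<close>, up to the constant \<open>exp c\<close>.\<close>
    also have "prob ?E \<le> exp c * exp (p1 * (exp c - 1) * (\<rho>2 * real (Suc k))) * exp (- c * (\<rho> * real (Suc k)))"
      using indep_processes_tail[OF hmm \<open>filtration_on M F\<close> le p1 c(1) l2 \<open>indep_processes M l1 l2\<close>] .
    also have "\<dots> = exp c * exp (real (Suc k) * (- d))"
      by (simp only: mult.assoc exp_add[symmetric]) (simp add: d_def algebra_simps)
    also have "\<dots> = exp c * exp (- d) ^ Suc k"
      by (simp only: exp_of_nat_mult)
    finally show ?thesis by simp
  qed
  have "summable (\<lambda>k. ?P2 k + exp c * exp (- d) ^ Suc k)"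
  proof (intro summable_add summable_mult)
    show "summable ?P2"
      using \<open>l2 \<in> Lambda_processes M \<rho>2\<close> by (simp add: Lambda_processes_def)
    show "summable (\<lambda>k. exp (- d) ^ Suc k)"
      using d by (subst summable_Suc_iff) (auto intro!: summable_geometric)
  qed
  then have "summable (\<lambda>k. \<P>(\<omega> in M. real (\<Sum>t<Suc k. ?l t \<omega>) > \<rho> * real (Suc k)))"
    by (rule summable_comparison_test[rotated]) (use bound in auto)
  with bin show "?l \<in> Lambda_processes M \<rho>" by (simp add: Lambda_processes_def)
qed

end
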